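(* Let $R_1(x)=1$, $R_2(x)=2x$, $R_{n+2}(x)=x(nx+2)R_{n+1}(x)+x(1-x^2)\frac{d}{dx}R_{n+1}(x)$. Define $t_0(x)=1$, $t_1(x)=x$ and $t_n(x)=\frac12(1+x)R_n(x)$ for $n\ge 2$. Define also $(M_n(x))_{n\ge 1}$ by $M_1(x)=1+x$ and $$M_{n+1}(x)=(nx^2+1)M_n(x)+x(1-x^2)\,\frac{d}{dx}M_n(x).$$ Then the Turán expressions $(t_{n+1}(x))^2-t_{n+2}(x)t_n(x)$ ($n\ge 0$) and $(M_{n+1}(x))^2-M_{n+2}(x)M_n(x)$ ($n\ge 1$) are all Hurwitz stable.
   Context: A polynomial $f\in\mathbb{C}[x]$ is Hurwitz stable if it is identically zero or $f(x)\ne0$ whenever $\Re(x)>0$. Combinatorially (not needed for the statement): the coefficient of $x^k$ in $t_n(x)$ counts permutations of $\{1,\dots,n\}$ whose longest alternating subsequence ($\pi_{i_1}>\pi_{i_2}<\pi_{i_3}>\cdots$) has length $k$, and $t_n(x)$ is also the up-down runs polynomial; $M_n(x)=xW_n(x^2)+\widetilde W_n(x^2)$, where $W_n$ and $\widetilde W_n$ are the generating polynomials of permutations of $\{1,\dots,n\}$ by number of interior peaks and left peaks, respectively. *)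

theory Defs
  imports Complex_Main "HOL-Computational_Algebra.Polynomial"
begin

definition hurwitz_stable :: "complex poly \<Rightarrow> bool" where
  "hurwitz_stable f \<longleftrightarrow> f = 0 \<or> (\<forall>x. Re x > 0 \<longrightarrow> poly f x \<noteq> 0)"

text \<open>The variable is \<open>[:0, 1:]\<close>; thus \<open>[:0, 2, of_nat n:]\<close> is \<open>x(nx + 2)\<close>
  and \<open>[:0, 1, 0, -1:]\<close> is \<open>x(1 - x^2)\<close>. The sequences \<open>R\<close> and \<open>M\<close> start at
  index 1; the value at index 0 is a dummy that no other equation uses.\<close>

fun R_poly :: "nat \<Rightarrow> complex poly" where
  "R_poly 0 = 0"
| "R_poly (Suc 0) = 1"
| "R_poly (Suc (Suc n)) =
     [:0, 2, of_nat n:] * R_poly (Suc n) + [:0, 1, 0, -1:] * pderiv (R_poly (Suc n))"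

lemma R_poly_2: "R_poly 2 = [:0, 2:]"
  by (simp add: numeral_2_eq_2)

text \<open>The formula with the factor 1/2 holds only from index 2 on; it would give
  \<open>(1 + x)/2\<close> instead of \<open>x\<close> at index 1.\<close>

definition t_poly :: "nat \<Rightarrow> complex poly" where
  "t_poly n = (if n = 0 then 1 else if n = 1 then [:0, 1:]
     else smult (1/2) ([:1, 1:] * R_poly n))"

fun M_poly :: "nat \<Rightarrow> complex poly" where
  "M_poly 0 = 0"
| "M_poly (Suc 0) = [:1, 1:]"
| "M_poly (Suc (Suc n)) =
     [:1, 0, of_nat (Suc n):] * M_poly (Suc n) + [:0, 1, 0, -1:] * pderiv (M_poly (Suc n))"

lemma M_poly_rec:
  assumes "n \<ge> 1"
  shows "M_poly (n + 1) = [:1, 0, of_nat n:] * M_poly n + [:0, 1, 0, -1:] * pderiv (M_poly n)"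
  using assms by (cases n) simp_all

end

theory Submission
  imports Defs "HOL-Computational_Algebra.Fundamental_Theorem_Algebra"
    "HOL-Library.Nonpos_Ints"
begin

text \<open>
  Substitute \<open>x = 2s / (1 + s\<^sup>2)\<close>, that is \<open>2 / x = s + 1 / s\<close>, so that \<open>Re x > 0\<close> forces
  \<open>Re s > 0\<close>. With the Eulerian polynomials \<open>A\<^sub>n\<close> one has
  \<open>t\<^sub>n(x) = 2 (1 + s)\<^bsup>n-1\<^esup> A\<^sub>n(s) / (1 + s\<^sup>2)\<^bsup>n\<^esup>\<close> and \<open>x M\<^sub>n(x) = (1 + x) t\<^sub>n(x)\<close> for \<open>n \<ge> 1\<close>, so both
  Turan expressions reduce to that of \<open>A\<^sub>n\<close>. If \<open>-\<sigma>\<^sub>i \<le> 0\<close> are the zeros of \<open>A\<^sub>n\<close>, then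
  \<open>A\<^sub>n\<^sub>+\<^sub>1 / A\<^sub>n = s + (\<Sum>i. s (1 + \<sigma>\<^sub>i) / (s + \<sigma>\<^sub>i))\<close>, which shows inductively that the zeros stay real and
  nonpositive, and the Turan expression is
  \<open>-s A\<^sub>n\<^sup>2 (1 + (\<Sum>i. (1 + \<sigma>\<^sub>i) (s\<^sup>2 + \<sigma>\<^sub>i) / (s + \<sigma>\<^sub>i)\<^sup>2))\<close>. For nonreal \<open>s\<close> with \<open>Re s > 0\<close>, all summands of the last factor lie
  in a common open half plane: divided by \<open>(1 + s)\<^sup>2\<close>, each has an imaginary part of sign opposite
  to \<open>Im s\<close>. For \<open>s > 0\<close> they are positive.
\<close>

section \<open>Half plane estimate for the summands\<close>

lemma Im_turan_term_sign:
  fixes s :: complex and \<sigma> :: real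
  assumes "Re s > 0" "Im s \<noteq> 0" "\<sigma> \<ge> 0"
  shows "Im s * Im ((s\<^sup>2 + of_real \<sigma>) / ((s + of_real \<sigma>)\<^sup>2 * (1 + s)\<^sup>2)) < 0"
proof -
  \<comment> \<open>\<open>(s + \<sigma>) (1 + s) = P + Q\<close>, and each term of \<open>P * cnj (P + Q)\<^sup>2\<close> has an imaginary part of the required sign\<close>
  define P Q where "P = s\<^sup>2 + of_real \<sigma>" and "Q = of_real (1 + \<sigma>) * s"
  have den: "(s + of_real \<sigma>)\<^sup>2 * (1 + s)\<^sup>2 = (P + Q)\<^sup>2"
    unfolding P_def Q_def by (simp add: algebra_simps power2_eq_square)
  have ImP: "Im P = 2 * Re s * Im s" by (simp add: P_def power2_eq_square)
  have "P \<noteq> 0" using ImP assms by auto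
  have "P + Q = (s + of_real \<sigma>) * (1 + s)"
    unfolding P_def Q_def by (simp add: algebra_simps power2_eq_square)
  moreover have "s + of_real \<sigma> \<noteq> 0" "1 + s \<noteq> 0"
    using assms by (auto simp: complex_eq_iff)
  ultimately have PQ: "P + Q \<noteq> 0" by simp
  have "P * cnj ((P + Q)\<^sup>2) = P * cnj P * (cnj P + 2 * cnj Q) + P * (cnj Q)\<^sup>2"
    by (simp add: algebra_simps power2_eq_square)
  also have "P * cnj P = of_real ((cmod P)\<^sup>2)"
    by (rule complex_norm_square[symmetric])
  finally have "Im (P * cnj ((P + Q)\<^sup>2)) =
      (cmod P)\<^sup>2 * (Im (cnj P) + 2 * Im (cnj Q)) + Im (P * (cnj Q)\<^sup>2)"
    by simp
  also have "Im (P * (cnj Q)\<^sup>2) = - 2 * (1 + \<sigma>)\<^sup>2 * \<sigma> * Re s * Im s"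
    by (simp add: P_def Q_def power2_eq_square algebra_simps)
  finally have "Im s * Im (P * cnj ((P + Q)\<^sup>2)) =
      - (Im s)\<^sup>2 * ((cmod P)\<^sup>2 * (2 * Re s + 2 * (1 + \<sigma>)) + 2 * (1 + \<sigma>)\<^sup>2 * \<sigma> * Re s)"
    by (simp add: ImP Q_def) (simp add: algebra_simps power2_eq_square)
  also have "\<dots> < 0"
  proof -
    have "(cmod P)\<^sup>2 * (2 * Re s + 2 * (1 + \<sigma>)) > 0"
      using assms \<open>P \<noteq> 0\<close> by simp
    moreover have "2 * (1 + \<sigma>)\<^sup>2 * \<sigma> * Re s \<ge> 0" using assms by simp
    ultimately show ?thesis
      using assms by (intro mult_neg_pos add_pos_nonneg) simp_all
  qed
  finally have neg: "Im s * Im (P * cnj ((P + Q)\<^sup>2)) < 0" .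
  \<comment> \<open>Expanding by the conjugate of the denominator leaves a positive real
    denominator, so the sign just found is that of the quotient.\<close>
  have "P / (P + Q)\<^sup>2 = P * cnj ((P + Q)\<^sup>2) / of_real ((cmod ((P + Q)\<^sup>2))\<^sup>2)"
    by (subst complex_div_cnj) simp
  hence "Im s * Im (P / (P + Q)\<^sup>2) =
      Im s * Im (P * cnj ((P + Q)\<^sup>2)) / (cmod ((P + Q)\<^sup>2))\<^sup>2"
    by (simp only: Im_divide_of_real times_divide_eq_right)
  also have "\<dots> < 0"
    using neg PQ by (intro divide_neg_pos) simp_all
  finally show ?thesis unfolding den P_def[symmetric] .
qed

section \<open>Sums over the zeros of a polynomial\<close>

lemma complex_nonpos_Reals_ex:
  "r \<in> \<real>\<^sub>\<le>\<^sub>0 \<Longrightarrow> \<exists>\<sigma>\<ge>0. r = - complex_of_real \<sigma>"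
  by (intro exI[of _ "- Re r"]) (auto simp: complex_nonpos_Reals_iff complex_eq_iff)

text \<open>The map \<open>g\<close> will be a real part, or an imaginary part taken after a fixed
  complex scaling; its sign on each summand carries over to the sum.\<close>

lemma additive_sum_mset_nonneg:
  fixes g :: "'a :: comm_monoid_add \<Rightarrow> real"
  assumes "g 0 = 0" "\<And>a b. g (a + b) = g a + g b" "\<And>r. r \<in># A \<Longrightarrow> g (f r) \<ge> 0"
  shows "g (\<Sum>r\<in>#A. f r) \<ge> 0"
  using assms(3) by (induction A) (auto simp: assms(1,2))

text \<open>Logarithmic differentiation: \<open>p' / p = S1\<close>, and \<open>S1' = - S2\<close>
  then gives \<open>p'' / p = S1^2 - S2\<close>. The induction adds one linear factor at a
  time.\<close>

lemma pderiv_prod_linear: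
  fixes s :: "'a :: field"
  assumes "s \<notin># A"
  defines "p \<equiv> (\<Prod>r\<in>#A. [:- r, 1:])"
  shows "poly (pderiv p) s = poly p s * (\<Sum>r\<in>#A. 1 / (s - r))"
    and "poly (pderiv (pderiv p)) s =
           poly p s * ((\<Sum>r\<in>#A. 1 / (s - r))\<^sup>2 - (\<Sum>r\<in>#A. 1 / (s - r)\<^sup>2))"
  using assms(1) unfolding p_def
proof (induction A)
  case empty
  case 1 show ?case by simp
  case 2 show ?case by simp
next
  case (add r A)
  let ?p = "\<Prod>r\<in>#A. [:- r, 1:]"
  have d: "pderiv ([:- r, 1:] * ?p) = [:- r, 1:] * pderiv ?p + ?p"
    by (subst pderiv_mult) (simp add: pderiv_pCons)
  have dd: "pderiv (pderiv ([:- r, 1:] * ?p)) = [:- r, 1:] * pderiv (pderiv ?p) + 2 * pderiv ?p"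
    unfolding d by (subst pderiv_add, subst pderiv_mult) (simp add: pderiv_pCons)
  \<comment> \<open>Naming the reciprocal makes both claims polynomial consequences of
    \<open>(s - r) * u = 1\<close>.\<close>
  define u P where "u = 1 / (s - r)" and "P = poly ?p s"
  define S1 S2 where "S1 = (\<Sum>r\<in>#A. 1 / (s - r))" and "S2 = (\<Sum>r\<in>#A. 1 / (s - r)\<^sup>2)"
  have S: "(\<Sum>r\<in>#add_mset r A. 1 / (s - r)) = u + S1"
    "(\<Sum>r\<in>#add_mset r A. 1 / (s - r)\<^sup>2) = u\<^sup>2 + S2"
    by (simp_all add: u_def S1_def S2_def power_divide)
  have P: "poly ([:- r, 1:] * ?p) s = (s - r) * P" by (simp add: P_def algebra_simps)
  {
    case 1
    hence u: "(s - r) * u = 1" and "s \<notin># A" by (auto simp: u_def)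
    hence IH: "poly (pderiv ?p) s = P * S1" using add(1) by (simp add: P_def S1_def)
    have "poly (pderiv ([:- r, 1:] * ?p)) s = (s - r) * (P * S1) + P"
      unfolding d using IH by (simp add: P_def algebra_simps)
    also have "\<dots> = (s - r) * P * (u + S1)" using u by algebra
    finally show ?case unfolding S by (simp only: image_mset_add_mset prod_mset.add_mset P)
  next
    case 2
    hence u: "(s - r) * u = 1" and "s \<notin># A" by (auto simp: u_def)
    hence IH: "poly (pderiv ?p) s = P * S1" "poly (pderiv (pderiv ?p)) s = P * (S1\<^sup>2 - S2)"
      using add(1,2) by (simp_all add: P_def S1_def S2_def)
    have "poly (pderiv (pderiv ([:- r, 1:] * ?p))) s = (s - r) * (P * (S1\<^sup>2 - S2)) + 2 * (P * S1)"
      unfolding dd by (simp add: IH(1) algebra_simps) (simp add: IH(2) algebra_simps)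
    also have "\<dots> = (s - r) * P * ((u + S1)\<^sup>2 - (u\<^sup>2 + S2))" using u by algebra
    finally show ?case unfolding S by (simp only: image_mset_add_mset prod_mset.add_mset P)
  }
qed

section \<open>Eulerian polynomials and their zeros\<close>

text \<open>Normalised with a factor \<open>x\<close>: the values at 1 and 2 are \<open>x\<close>
  and \<open>x + x^2\<close>, so that the degree equals the index.\<close>

fun eulerian_poly :: "nat \<Rightarrow> complex poly" where
  "eulerian_poly 0 = 1"
| "eulerian_poly (Suc n) =
     [:0, of_nat (Suc n):] * eulerian_poly n + [:0, 1, -1:] * pderiv (eulerian_poly n)"

text \<open>The leading term contributes \<open>n + 1\<close> through the multiplication and
  \<open>-n\<close> through the derivative, which leaves 1.\<close>

lemma eulerian_poly_monic:
  "degree (eulerian_poly n) = n \<and> lead_coeff (eulerian_poly n) = 1"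
proof (induction n)
  case (Suc n)
  let ?p = "eulerian_poly n"
  have deg: "degree ?p = n" and one: "coeff ?p n = 1" using Suc by auto
  have coeff: "coeff (eulerian_poly (Suc n)) (Suc k) =
      of_nat (Suc n) * coeff ?p k + of_nat (Suc k) * coeff ?p (Suc k) - of_nat k * coeff ?p k" for k
    by (cases k) (simp_all add: coeff_pderiv)
  have lead: "coeff (eulerian_poly (Suc n)) (Suc n) = 1"
    unfolding coeff using deg one by (simp add: coeff_eq_0 algebra_simps)
  have "degree (eulerian_poly (Suc n)) \<le> Suc n"
  proof (rule degree_le, intro allI impI)
    fix i assume "Suc n < i"
    then obtain k where "i = Suc k" "k > n" by (cases i) auto
    thus "coeff (eulerian_poly (Suc n)) i = 0"
      unfolding \<open>i = Suc k\<close> coeff using deg by (simp add: coeff_eq_0)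
  qed
  with lead show ?case by (metis le_antisym le_degree one_neq_zero)
qed simp

text \<open>A monic polynomial over an algebraically closed field splits without a scalar factor;
  \<open>A\<close> lists the zeros with multiplicity.\<close>

lemma eulerian_poly_factorization:
  obtains A where "size A = n" "eulerian_poly n = (\<Prod>r\<in>#A. [:- r, 1:])"
    "\<And>r. r \<in># A \<longleftrightarrow> poly (eulerian_poly n) r = 0"
proof -
  have "eulerian_poly n \<noteq> 0" using eulerian_poly_monic[of n] by auto
  then obtain A where A: "size A = n" "eulerian_poly n = (\<Prod>r\<in>#A. [:- r, 1:])"
    using alg_closed_imp_factorization[of "eulerian_poly n"] eulerian_poly_monic[of n] by auto
  moreover have "r \<in># A \<longleftrightarrow> poly (eulerian_poly n) r = 0" for r
    unfolding A(2) poly_prod_mset by (auto simp: prod_mset_zero_iff)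
  ultimately show thesis using that by blast
qed

text \<open>Off the nonpositive axis the quotient \<open>q\<close> of consecutive polynomials is
  defined by induction. It is positive for \<open>z > 0\<close>, and for nonreal \<open>z\<close>
  its imaginary part has the sign of \<open>Im z\<close>; so it never vanishes.\<close>

lemma eulerian_poly_root_nonpos:
  "poly (eulerian_poly n) z = 0 \<Longrightarrow> z \<in> \<real>\<^sub>\<le>\<^sub>0"
proof (induction n arbitrary: z)
  case (Suc n)
  show ?case
  proof (rule ccontr)
    assume z: "z \<notin> \<real>\<^sub>\<le>\<^sub>0"
    obtain A where A: "size A = n" "eulerian_poly n = (\<Prod>r\<in>#A. [:- r, 1:])"
      "\<And>r. r \<in># A \<longleftrightarrow> poly (eulerian_poly n) r = 0"
      using eulerian_poly_factorization[of n] by metis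
    have nz: "poly (eulerian_poly n) z \<noteq> 0" using Suc.IH z by blast
    have zA: "z \<notin># A" using nz A(3) by blast
    define q where "q = z + (\<Sum>r\<in>#A. z * (1 - r) / (z - r))"
    \<comment> \<open>Uses \<open>z * (1 - r) = z * (z - r) + z * (1 - z)\<close>. The
      \<open>n\<close> copies of \<open>z\<close> in the sum and the one in front give the
      coefficient \<open>n + 1\<close> of the recurrence.\<close>
    have "q = z + (\<Sum>r\<in>#A. z + z * (1 - z) * (1 / (z - r)))"
      unfolding q_def using zA by (intro arg_cong2[where f = "(+)"] refl arg_cong[where f = sum_mset] image_mset_cong)
        (auto simp: divide_simps, simp add: algebra_simps)
    also have "\<dots> = of_nat (Suc n) * z + z * (1 - z) * (\<Sum>r\<in>#A. 1 / (z - r))"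
      unfolding sum_mset.distrib sum_mset_distrib_left[symmetric]
      by (simp add: A(1) algebra_simps)
    finally have q: "q = of_nat (Suc n) * z + z * (1 - z) * (\<Sum>r\<in>#A. 1 / (z - r))" .
    have "poly (eulerian_poly (Suc n)) z = of_nat (Suc n) * z * poly (eulerian_poly n) z +
        z * (1 - z) * poly (pderiv (eulerian_poly n)) z"
      by (simp add: algebra_simps)
    also have "poly (pderiv (eulerian_poly n)) z =
        poly (eulerian_poly n) z * (\<Sum>r\<in>#A. 1 / (z - r))"
      using pderiv_prod_linear(1)[OF zA, folded A(2)] .
    finally have "poly (eulerian_poly (Suc n)) z = poly (eulerian_poly n) z * q"
      unfolding q by (simp only: algebra_simps)
    with Suc.prems nz have q0: "q = 0" by (metis mult_eq_0_iff)
    have root: "\<exists>\<sigma>\<ge>0. r = - of_real \<sigma>" if "r \<in># A" for r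
      using Suc.IH A(3) that complex_nonpos_Reals_ex by blast
    show False
    proof (cases "Im z = 0")
      case True
      with z have "Re z > 0" by (auto simp: complex_nonpos_Reals_iff)
      have z_eq: "z = of_real (Re z)" using True by (simp add: complex_eq_iff)
      have "Re (\<Sum>r\<in>#A. z * (1 - r) / (z - r)) \<ge> 0"
      proof (rule additive_sum_mset_nonneg)
        fix r assume "r \<in># A"
        then obtain \<sigma> where "\<sigma> \<ge> 0" "r = - of_real \<sigma>" using root by blast
        hence "z * (1 - r) / (z - r) = of_real (Re z * (1 + \<sigma>) / (Re z + \<sigma>))"
          by (subst (1 2) z_eq) simp
        thus "Re (z * (1 - r) / (z - r)) \<ge> 0"
          using \<open>\<sigma> \<ge> 0\<close> \<open>Re z > 0\<close> by (simp only: Re_complex_of_real) simp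
      qed simp_all
      hence "Re q > 0" using \<open>Re z > 0\<close> by (simp add: q_def)
      thus False using q0 by simp
    next
      case False
      have "Im z * Im (\<Sum>r\<in>#A. z * (1 - r) / (z - r)) \<ge> 0"
      proof (rule additive_sum_mset_nonneg)
        fix r assume "r \<in># A"
        then obtain \<sigma> where \<sigma>: "\<sigma> \<ge> 0" "r = - of_real \<sigma>" using root by blast
        \<comment> \<open>Here \<open>z * cnj (z + \<sigma>) = |z|^2 + \<sigma> * z\<close> has
          imaginary part \<open>\<sigma> * Im z\<close>.\<close>
        have "Im (z * (1 - r) / (z - r)) = (1 + \<sigma>) * \<sigma> * Im z / (cmod (z - r))\<^sup>2"
          unfolding Im_divide cmod_power2 using \<sigma> by (simp add: algebra_simps)
        also have "Im z * \<dots> = (1 + \<sigma>) * \<sigma> * (Im z)\<^sup>2 / (cmod (z - r))\<^sup>2"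
          by (simp add: power2_eq_square)
        also have "\<dots> \<ge> 0" using \<sigma> by simp
        finally show "Im z * Im (z * (1 - r) / (z - r)) \<ge> 0" .
      qed (simp_all add: algebra_simps)
      \<comment> \<open>Strictness comes from the summand \<open>z\<close> in front, since a zero at
        the origin contributes nothing.\<close>
      moreover have "Im z * Im z > 0" using False by (simp add: zero_less_mult_iff) linarith
      ultimately have "Im z * Im q > 0" by (simp add: q_def distrib_left)
      thus False using q0 by simp
    qed
  qed
qed simp

section \<open>Turan expression of the Eulerian polynomials\<close>

text \<open>If \<open>q\<close> is the quotient of the polynomials at \<open>n + 1\<close> and
  \<open>n\<close>, the recurrence makes that of \<open>n + 2\<close> and \<open>n\<close> equal to
  \<open>q^2 + s * h\<close> with \<open>h = q + (1 - s) * q'\<close>. The Turan expression is thus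
  \<open>- s * p^2 * h\<close>, and \<open>h\<close> has no zero in the right half plane.\<close>

lemma eulerian_poly_turan_nonzero:
  assumes s: "Re s > 0"
  shows "(poly (eulerian_poly (Suc n)) s)\<^sup>2
           - poly (eulerian_poly (Suc (Suc n))) s * poly (eulerian_poly n) s \<noteq> 0"
proof -
  obtain A where A: "size A = n" "eulerian_poly n = (\<Prod>r\<in>#A. [:- r, 1:])"
    "\<And>r. r \<in># A \<longleftrightarrow> poly (eulerian_poly n) r = 0"
    using eulerian_poly_factorization[of n] by metis
  have s': "s \<notin> \<real>\<^sub>\<le>\<^sub>0" using s by (auto simp: complex_nonpos_Reals_iff)
  have nz: "poly (eulerian_poly n) s \<noteq> 0" using eulerian_poly_root_nonpos s' by blast
  have sA: "s \<notin># A" using nz A(3) by blast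
  define p S1 S2 where "p = poly (eulerian_poly n) s"
    and "S1 = (\<Sum>r\<in>#A. 1 / (s - r))" and "S2 = (\<Sum>r\<in>#A. 1 / (s - r)\<^sup>2)"
  have p: "poly (pderiv (eulerian_poly n)) s = p * S1"
    "poly (pderiv (pderiv (eulerian_poly n))) s = p * (S1\<^sup>2 - S2)"
    using pderiv_prod_linear[OF sA, folded A(2)] by (simp_all add: p_def S1_def S2_def)
  define h where "h = 1 + (\<Sum>r\<in>#A. (1 - r) * (s\<^sup>2 - r) / (s - r)\<^sup>2)"
  \<comment> \<open>Expansion of \<open>(1 - r) * (s^2 - r)\<close> in powers of
    \<open>s - r\<close>.\<close>
  have "h = 1 + (\<Sum>r\<in>#A. 1 + ((1 - s)\<^sup>2 * (1 / (s - r)) + - (s * (1 - s)\<^sup>2) * (1 / (s - r)\<^sup>2)))"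
    unfolding h_def using sA by (intro arg_cong2[where f = "(+)"] refl arg_cong[where f = sum_mset] image_mset_cong)
      (auto simp: divide_simps, simp add: algebra_simps power2_eq_square)
  also have "\<dots> = of_nat (Suc n) + (1 - s)\<^sup>2 * S1 - s * (1 - s)\<^sup>2 * S2"
    unfolding S1_def S2_def sum_mset.distrib sum_mset_distrib_left[symmetric] by (simp add: A(1))
  finally have h: "h = of_nat (Suc n) + (1 - s)\<^sup>2 * S1 - s * (1 - s)\<^sup>2 * S2" .
  have E1: "poly (eulerian_poly (Suc n)) s = of_nat (Suc n) * s * p + s * (1 - s) * (p * S1)"
    by (simp add: p p_def[symmetric] algebra_simps)
  have E2: "poly (eulerian_poly (Suc (Suc n))) s =
      (of_nat (Suc n) + 1) * s * poly (eulerian_poly (Suc n)) s +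
      s * (1 - s) * poly (pderiv (eulerian_poly (Suc n))) s"
    unfolding eulerian_poly.simps(2)[of "Suc n"] poly_add poly_mult by (simp add: algebra_simps)
  have dE1: "poly (pderiv (eulerian_poly (Suc n))) s = of_nat (Suc n) * p +
      (of_nat (Suc n) * s + 1 - 2 * s) * (p * S1) + s * (1 - s) * (p * (S1\<^sup>2 - S2))"
    unfolding eulerian_poly.simps(2) pderiv_add pderiv_mult poly_add poly_mult p p_def[symmetric]
    by (simp add: pderiv_pCons) (simp add: algebra_simps)
  have "(poly (eulerian_poly (Suc n)) s)\<^sup>2
           - poly (eulerian_poly (Suc (Suc n))) s * poly (eulerian_poly n) s = - s * p\<^sup>2 * h"
    unfolding E2 E1 dE1 h p_def[symmetric] by algebra
  moreover have "h \<noteq> 0"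
  proof
    assume h0: "h = 0"
    have root: "\<exists>\<sigma>\<ge>0. r = - of_real \<sigma>" if "r \<in># A" for r
      using eulerian_poly_root_nonpos A(3) that complex_nonpos_Reals_ex by blast
    show False
    proof (cases "Im s = 0")
      case True
      have s_eq: "s = of_real (Re s)" using True by (simp add: complex_eq_iff)
      have "Re (\<Sum>r\<in>#A. (1 - r) * (s\<^sup>2 - r) / (s - r)\<^sup>2) \<ge> 0"
      proof (rule additive_sum_mset_nonneg)
        fix r assume "r \<in># A"
        then obtain \<sigma> where "\<sigma> \<ge> 0" "r = - of_real \<sigma>" using root by blast
        hence "(1 - r) * (s\<^sup>2 - r) / (s - r)\<^sup>2 =
            of_real ((1 + \<sigma>) * ((Re s)\<^sup>2 + \<sigma>) / (Re s + \<sigma>)\<^sup>2)"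
          by (subst (1 2) s_eq) simp
        thus "Re ((1 - r) * (s\<^sup>2 - r) / (s - r)\<^sup>2) \<ge> 0"
          using \<open>\<sigma> \<ge> 0\<close> by (simp only: Re_complex_of_real) simp
      qed simp_all
      hence "Re h > 0" by (simp add: h_def)
      thus False using h0 by simp
    next
      case False
      define g where "g w = - (Im s * Im (w / (1 + s)\<^sup>2))" for w
      have g_add: "g (a + b) = g a + g b" for a b
        by (simp add: g_def add_divide_distrib algebra_simps)
      \<comment> \<open>The summand 1 of \<open>h\<close> is covered by the case
        \<open>\<sigma> = 0\<close> of the estimate, where the quotient is
        \<open>1 / (1 + s)^2\<close>.\<close>
      have "g 1 > 0"
        using Im_turan_term_sign[OF s False, of 0] s by (auto simp: g_def split: if_splits)
      moreover have "g (\<Sum>r\<in>#A. (1 - r) * (s\<^sup>2 - r) / (s - r)\<^sup>2) \<ge> 0"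
      proof (rule additive_sum_mset_nonneg)
        fix r assume "r \<in># A"
        then obtain \<sigma> where \<sigma>: "\<sigma> \<ge> 0" "r = - of_real \<sigma>" using root by blast
        define w where "w = (s\<^sup>2 + of_real \<sigma>) / ((s + of_real \<sigma>)\<^sup>2 * (1 + s)\<^sup>2)"
        have "(1 - r) * (s\<^sup>2 - r) / (s - r)\<^sup>2 / (1 + s)\<^sup>2 = of_real (1 + \<sigma>) * w"
          using \<sigma> by (simp add: w_def)
        hence "g ((1 - r) * (s\<^sup>2 - r) / (s - r)\<^sup>2) = (1 + \<sigma>) * - (Im s * Im w)"
          by (simp add: g_def)
        also have "\<dots> \<ge> 0"
          using Im_turan_term_sign[OF s False \<sigma>(1)] \<sigma>(1)
          by (intro mult_nonneg_nonneg) (simp_all add: w_def)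
        finally show "g ((1 - r) * (s\<^sup>2 - r) / (s - r)\<^sup>2) \<ge> 0" .
      qed (simp_all add: g_add, simp add: g_def)
      ultimately have "g h > 0" by (simp add: h_def g_add)
      thus False using h0 by (simp add: g_def)
    qed
  qed
  ultimately show ?thesis using nz s by (auto simp: p_def)
qed

section \<open>Recurrence for \<open>t_poly\<close> and its relation to
  \<open>M_poly\<close>\<close>

text \<open>Applying \<open>x(1 - x^2) d/dx\<close> to \<open>1 + x\<close> yields
  \<open>x(1 - x)(1 + x)\<close>, which accounts for the change of coefficient from
  \<open>x((n - 1)x + 2)\<close> to \<open>x(nx + 1)\<close>. The initial values fit the same
  rule.\<close>

lemma t_poly_Suc:
  "t_poly (Suc n) = [:0, 1, of_nat n:] * t_poly n + [:0, 1, 0, -1:] * pderiv (t_poly n)"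
proof -
  consider "n = 0" | "n = 1" | k where "n = Suc (Suc k)"
    by (metis One_nat_def not0_implies_Suc)
  thus ?thesis
  proof cases
    case 3
    define R where "R = R_poly n"
    have t: "t_poly n = smult (1/2) ([:1, 1:] * R)" using 3 by (simp add: t_poly_def R_def)
    have "t_poly (Suc n) = smult (1/2) ([:1, 1:] *
        ([:0, 2, of_nat (Suc k):] * R + [:0, 1, 0, -1:] * pderiv R))"
      using 3 by (simp add: t_poly_def R_def)
    also have "\<dots> = smult (1/2) ([:0, 1, of_nat n:] * ([:1, 1:] * R) +
        [:0, 1, 0, -1:] * (R + [:1, 1:] * pderiv R))"
    proof -
      have c: "[:0, 2, of_nat (Suc k):] * [:1, 1:] = [:0, 1, of_nat n:] * [:1, 1:] + [:0, 1, 0, -1 :: complex:]"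
        using 3 by simp
      have "[:1, 1:] * ([:0, 2, of_nat (Suc k):] * R + [:0, 1, 0, -1:] * pderiv R) =
          ([:0, 2, of_nat (Suc k):] * [:1, 1:]) * R + [:0, 1, 0, -1:] * ([:1, 1:] * pderiv R)"
        by (simp only: algebra_simps)
      also have "\<dots> = [:0, 1, of_nat n:] * ([:1, 1:] * R) +
          [:0, 1, 0, -1:] * (R + [:1, 1:] * pderiv R)"
        unfolding c by (simp only: algebra_simps)
      finally show ?thesis by (rule arg_cong)
    qed
    also have "R + [:1, 1:] * pderiv R = pderiv ([:1, 1:] * R)"
      by (subst pderiv_mult) (simp add: pderiv_pCons)
    finally show ?thesis
      by (simp only: t pderiv_smult mult_smult_right smult_add_right)
  qed (simp_all add: t_poly_def pderiv_pCons numeral_2_eq_2)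
qed

text \<open>Multiplied by \<open>x\<close>, the recurrence for \<open>M_poly\<close> becomes that
  for \<open>t_poly\<close> times \<open>1 + x\<close>. The index starts at 1 because
  \<open>M_poly 0\<close> is a dummy.\<close>

lemma M_poly_t_poly:
  "[:0, 1:] * M_poly (Suc n) = [:1, 1:] * t_poly (Suc n)"
proof (induction n)
  case 0
  show ?case by (simp add: t_poly_def)
next
  case (Suc n)
  define M t where "M = M_poly (Suc n)" and "t = t_poly (Suc n)"
  have IH: "[:0, 1:] * M = [:1, 1:] * t" using Suc by (simp add: M_def t_def)
  \<comment> \<open>Differentiating the induction hypothesis expresses \<open>x * M'\<close> by
    \<open>t\<close>, \<open>t'\<close> and \<open>M\<close>.\<close>
  have dM: "[:0, 1:] * pderiv M = t + [:1, 1:] * pderiv t - M"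
  proof -
    have "pderiv ([:0, 1:] * M) = [:0, 1:] * pderiv M + M"
      by (subst pderiv_mult) (simp add: pderiv_pCons)
    moreover have "pderiv ([:1, 1:] * t) = [:1, 1:] * pderiv t + t"
      by (subst pderiv_mult) (simp add: pderiv_pCons)
    ultimately show ?thesis using IH by (simp add: algebra_simps)
  qed
  have "[:0, 1:] * M_poly (Suc (Suc n)) =
      [:1, 0, of_nat (Suc n):] * ([:0, 1:] * M) + [:0, 1, 0, -1:] * ([:0, 1:] * pderiv M)"
    unfolding M_poly.simps M_def[symmetric] by (simp only: algebra_simps)
  also have "\<dots> = [:1, 0, of_nat (Suc n):] * ([:0, 1:] * M) - [:1, 0, -1:] * ([:0, 1:] * M) +
      [:0, 1, 0, -1:] * (t + [:1, 1:] * pderiv t)"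
  proof -
    have "[:0, 1, 0, -1:] = [:1, 0, -1:] * [:0, 1 :: complex:]" by simp
    thus ?thesis unfolding dM by (simp only: algebra_simps)
  qed
  also have "\<dots> = ([:1, 0, of_nat (Suc n):] * [:1, 1:] - [:1, 0, -1:] * [:1, 1:] + [:0, 1, 0, -1:]) * t +
      [:0, 1, 0, -1:] * ([:1, 1:] * pderiv t)"
    unfolding IH by (simp only: algebra_simps)
  also have "[:1, 0, of_nat (Suc n):] * [:1, 1:] - [:1, 0, -1:] * [:1, 1:] + [:0, 1, 0, -1:] =
      [:1, 1:] * [:0, 1, of_nat (Suc n) :: complex:]"
    by simp
  also have "\<dots> * t + [:0, 1, 0, -1:] * ([:1, 1:] * pderiv t) = [:1, 1:] * t_poly (Suc (Suc n))"
    unfolding t_poly_Suc[of "Suc n"] t_def[symmetric] by (simp only: algebra_simps)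
  finally show ?case .
qed

section \<open>Change of variable from \<open>x\<close> to \<open>s\<close>\<close>

lemma t_poly_eulerian:
  assumes "Re s > 0" "1 + s\<^sup>2 \<noteq> 0"
  shows "poly (t_poly (Suc n)) (2 * s / (1 + s\<^sup>2)) =
           2 * (1 + s) ^ n * poly (eulerian_poly (Suc n)) s / (1 + s\<^sup>2) ^ Suc n"
  using assms
proof (induction n arbitrary: s)
  case 0
  show ?case by (simp add: t_poly_def)
next
  case (Suc n)
  define x where "x s = 2 * s / (1 + s\<^sup>2)" for s :: complex
  define E where "E = eulerian_poly (Suc n)"
  define F where "F s = 2 * (1 + s) ^ n * poly E s / (1 + s\<^sup>2) ^ Suc n" for s
  define D where "D = 1 + s\<^sup>2"
  have D: "D \<noteq> 0" and s: "1 + s \<noteq> 0" using Suc.prems by (auto simp: D_def complex_eq_iff)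
  have dx: "(x has_field_derivative 2 * (1 - s\<^sup>2) / D\<^sup>2) (at s)"
    unfolding x_def[abs_def] D_def using Suc.prems
    by (auto intro!: derivative_eq_intros simp: power2_eq_square divide_simps)
  have L: "((\<lambda>s. poly (t_poly (Suc n)) (x s)) has_field_derivative
      poly (pderiv (t_poly (Suc n))) (x s) * (2 * (1 - s\<^sup>2) / D\<^sup>2)) (at s)"
    by (rule DERIV_chain2[OF poly_DERIV dx])
  \<comment> \<open>The two fractions are the logarithmic derivatives of \<open>(1 + s)^n\<close>
    and \<open>D^(n + 1)\<close>.\<close>
  define F' where "F' = 2 * (1 + s) ^ n * ((of_nat n / (1 + s) - of_nat (Suc n) * 2 * s / D) * poly E s
      + poly (pderiv E) s) / D ^ Suc n"
  have R: "(F has_field_derivative F') (at s)"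
  proof -
    define c d where "c = 2 * (1 + s) ^ n" and "d = D ^ Suc n"
    have "of_nat n * (1 + s) ^ (n - Suc 0) = of_nat n * (1 + s) ^ n / (1 + s)"
      using s by (cases n) auto
    hence h1: "((\<lambda>z. 2 * (1 + z) ^ n) has_field_derivative c * (of_nat n / (1 + s))) (at s)"
      by (auto intro!: derivative_eq_intros simp: c_def)
    have h2: "((\<lambda>z. (1 + z\<^sup>2) ^ Suc n) has_field_derivative
        d * (of_nat (Suc n) * 2 * s / D)) (at s)"
      using D by (auto intro!: derivative_eq_intros simp: d_def D_def simp del: power_Suc) simp
    have d: "(1 + s\<^sup>2) ^ Suc n = d" "2 * (1 + s) ^ n = c" by (simp_all add: c_def d_def D_def)
    have "d \<noteq> 0" using D by (simp add: d_def)
    have "(c * a * e + e' * c) * d - c * e * (d * b) = (c * ((a - b) * e + e')) * d"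
      for a b e e' by (simp add: algebra_simps)
    hence "(c * (of_nat n / (1 + s)) * poly E s + poly (pderiv E) s * c) * d
        - c * poly E s * (d * (of_nat (Suc n) * 2 * s / D)) =
      (c * ((of_nat n / (1 + s) - of_nat (Suc n) * 2 * s / D) * poly E s + poly (pderiv E) s)) * d" .
    hence "((c * (of_nat n / (1 + s)) * poly E s + poly (pderiv E) s * c) * d
        - c * poly E s * (d * (of_nat (Suc n) * 2 * s / D))) / (d * d) = F'"
      using \<open>d \<noteq> 0\<close> by (simp add: F'_def c_def d_def[symmetric] del: power_Suc)
    with DERIV_divide[OF DERIV_mult[OF h1 poly_DERIV[of E]] h2] \<open>d \<noteq> 0\<close> show ?thesis
      unfolding F_def[abs_def] d by simp
  qed
  \<comment> \<open>The conditions on \<open>s\<close> are open, so the induction hypothesis holds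
    near \<open>s\<close> and may be differentiated.\<close>
  have "\<forall>\<^sub>F z in nhds s. z \<in> {z. Re z > 0} \<inter> {z. 1 + z\<^sup>2 \<noteq> 0}"
    using Suc.prems by (intro eventually_nhds_in_open open_Int open_Collect_less open_Collect_neq continuous_intros) auto
  hence "\<forall>\<^sub>F z in nhds s. poly (t_poly (Suc n)) (x z) = F z"
    by eventually_elim (use Suc.IH in \<open>simp add: x_def F_def E_def\<close>)
  hence eq: "poly (pderiv (t_poly (Suc n))) (x s) * (2 * (1 - s\<^sup>2) / D\<^sup>2) = F'"
    using L R DERIV_unique DERIV_cong_ev[OF refl _ refl] by metis
  have "poly (t_poly (Suc (Suc n))) (x s) =
     (x s + of_nat (Suc n) * (x s)\<^sup>2) * poly (t_poly (Suc n)) (x s) +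
     x s * (1 - (x s)\<^sup>2) * poly (pderiv (t_poly (Suc n))) (x s)"
    unfolding t_poly_Suc[of "Suc n"] by (simp add: algebra_simps power2_eq_square)
  also have "poly (t_poly (Suc n)) (x s) = F s" using Suc by (simp add: x_def F_def E_def)
  \<comment> \<open>The derivative of \<open>x\<close> is split off as a factor instead of being
    divided out, because it vanishes at \<open>s = 1\<close>.\<close>
  also have "x s * (1 - (x s)\<^sup>2) = s * (1 - s\<^sup>2) / D * (2 * (1 - s\<^sup>2) / D\<^sup>2)"
    using D by (simp add: x_def D_def[symmetric] divide_simps)
       (simp add: D_def algebra_simps power2_eq_square)
  also have "\<dots> * poly (pderiv (t_poly (Suc n))) (x s) = s * (1 - s\<^sup>2) / D * F'"
    unfolding eq[symmetric] by (simp only: mult_ac)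
  also have "(x s + of_nat (Suc n) * (x s)\<^sup>2) * F s + s * (1 - s\<^sup>2) / D * F' =
    2 * (1 + s) ^ Suc n * poly (eulerian_poly (Suc (Suc n))) s / D ^ Suc (Suc n)"
  proof -
    define c d e e' where "c = 2 * (1 + s) ^ n" and "d = D ^ Suc n"
      and "e = poly E s" and "e' = poly (pderiv E) s"
    \<comment> \<open>This is the coefficient \<open>(n + 2) * s\<close> of the Eulerian recurrence
      times \<open>(1 + s) / D\<close>, the factor by which the prefactor grows.\<close>
    have k: "x s + of_nat (Suc n) * (x s)\<^sup>2 +
        s * (1 - s\<^sup>2) / D * (of_nat n / (1 + s) - of_nat (Suc n) * 2 * s / D) =
        of_nat (n + 2) * s * (1 + s) / D"
      using D s by (simp add: x_def D_def[symmetric] divide_simps)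
        (simp add: D_def algebra_simps power2_eq_square)
    have E: "poly (eulerian_poly (Suc (Suc n))) s = of_nat (n + 2) * s * e + s * (1 - s) * e'"
      unfolding eulerian_poly.simps(2)[of "Suc n"] E_def[symmetric]
      by (simp add: e_def e'_def algebra_simps)
    have "X * (c * e / d) + Y * (c * (Z * e + e') / d) = c / d * ((X + Y * Z) * e + Y * e')" for X Y Z
      by (simp add: add_divide_distrib algebra_simps)
    hence "(x s + of_nat (Suc n) * (x s)\<^sup>2) * F s + s * (1 - s\<^sup>2) / D * F' =
        c / d * ((x s + of_nat (Suc n) * (x s)\<^sup>2 +
        s * (1 - s\<^sup>2) / D * (of_nat n / (1 + s) - of_nat (Suc n) * 2 * s / D)) * e
        + s * (1 - s\<^sup>2) / D * e')"
      unfolding F_def F'_def c_def d_def e_def e'_def D_def[symmetric] .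
    also have "\<dots> = c * (1 + s) * (of_nat (n + 2) * s * e + s * (1 - s) * e') / (d * D)"
      unfolding k by (simp add: power2_eq_square add_divide_distrib diff_divide_distrib algebra_simps)
    finally show ?thesis unfolding E by (simp add: c_def d_def mult_ac)
  qed
  finally show ?case by (simp only: x_def D_def)
qed

section \<open>Transfer to \<open>t_poly\<close> and \<open>M_poly\<close>\<close>

theorem proposition3p9:
  shows "(\<forall>n. hurwitz_stable ((t_poly (n + 1))\<^sup>2 - t_poly (n + 2) * t_poly n)) \<and>
         (\<forall>n\<ge>1. hurwitz_stable ((M_poly (n + 1))\<^sup>2 - M_poly (n + 2) * M_poly n))"
proof -
  have T: "poly ((t_poly (Suc (Suc n)))\<^sup>2 - t_poly (Suc (Suc (Suc n))) * t_poly (Suc n)) x \<noteq> 0"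
    if "Re x > 0" for n x
  proof -
    \<comment> \<open>The quadratic \<open>x * s^2 - 2 * s + x\<close> is
      \<open>x = 2s / (1 + s^2)\<close> cleared of its denominator.\<close>
    have "\<exists>s. poly [:x, -2, x:] s = 0"
      using that by (intro alg_closed_imp_poly_has_root) auto
    then obtain s where "x + s * (s * x - 2) = 0" by auto
    hence xs: "x * (1 + s\<^sup>2) = 2 * s" by (simp add: algebra_simps power2_eq_square)
    have "x \<noteq> 0" using that by auto
    have D: "1 + s\<^sup>2 \<noteq> 0" using xs by auto
    have x: "x = 2 * s / (1 + s\<^sup>2)" using xs D by (simp add: field_simps)
    have "Re s > 0"
    proof -
      \<comment> \<open>This is \<open>2 / x = s + 1 / s\<close> times \<open>|x|^2 * |s|^2\<close>;
        its real part compares the signs of \<open>Re s\<close> and \<open>Re x\<close>.\<close>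
      have "x * cnj x * (cnj s + s * (s * cnj s)) = 2 * (s * cnj s) * cnj x"
        using xs by algebra
      hence "of_real ((cmod x)\<^sup>2) * (cnj s + s * of_real ((cmod s)\<^sup>2))
          = 2 * of_real ((cmod s)\<^sup>2) * cnj x"
        by (simp only: complex_norm_square)
      from arg_cong[OF this, of Re]
      have "(cmod x)\<^sup>2 * (1 + (cmod s)\<^sup>2) * Re s = 2 * (cmod s)\<^sup>2 * Re x"
        by (simp add: algebra_simps)
      moreover have "s \<noteq> 0" using xs \<open>x \<noteq> 0\<close> by auto
      ultimately have "(cmod x)\<^sup>2 * (1 + (cmod s)\<^sup>2) * Re s > 0" using that by simp
      moreover have "(cmod x)\<^sup>2 * (1 + (cmod s)\<^sup>2) \<ge> 0" by simp
      ultimately show ?thesis by (simp only: zero_less_mult_iff) argo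
    qed
    let ?E = "\<lambda>n. poly (eulerian_poly n) s"
    have t: "poly (t_poly (Suc m)) x = 2 * (1 + s) ^ m * ?E (Suc m) / (1 + s\<^sup>2) ^ Suc m" for m
      unfolding x by (rule t_poly_eulerian) fact+
    \<comment> \<open>The exponents of \<open>1 + s\<close> and \<open>1 + s^2\<close> are linear in
      the index, so both products carry the same factor.\<close>
    have "poly ((t_poly (Suc (Suc n)))\<^sup>2 - t_poly (Suc (Suc (Suc n))) * t_poly (Suc n)) x =
        4 * ((1 + s) ^ Suc n)\<^sup>2 / ((1 + s\<^sup>2) ^ Suc (Suc n))\<^sup>2 *
        ((?E (Suc (Suc n)))\<^sup>2 - ?E (Suc (Suc (Suc n))) * ?E (Suc n))"
    proof -
      define c D d where "c = (1 + s) ^ n" and "D = 1 + s\<^sup>2" and "d = D ^ Suc n"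
      have t': "poly (t_poly (Suc n)) x = 2 * c * ?E (Suc n) / d"
        "poly (t_poly (Suc (Suc n))) x = 2 * (c * (1 + s)) * ?E (Suc (Suc n)) / (d * D)"
        "poly (t_poly (Suc (Suc (Suc n)))) x =
           2 * (c * (1 + s)\<^sup>2) * ?E (Suc (Suc (Suc n))) / (d * D\<^sup>2)"
        unfolding t by (simp_all add: c_def d_def D_def power2_eq_square mult_ac del: eulerian_poly.simps)
      have r: "(1 + s) ^ Suc n = c * (1 + s)" "(1 + s\<^sup>2) ^ Suc (Suc n) = d * D"
        by (simp_all add: c_def d_def D_def)
      have "d \<noteq> 0" "D \<noteq> 0" using D by (simp_all add: d_def D_def)
      thus ?thesis
        unfolding poly_diff poly_mult poly_power t' r
        by (simp add: field_simps power2_eq_square del: eulerian_poly.simps)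
    qed
    moreover have "1 + s \<noteq> 0" using \<open>Re s > 0\<close> by (auto simp: complex_eq_iff)
    ultimately show ?thesis
      using D eulerian_poly_turan_nonzero[OF \<open>Re s > 0\<close>, of "Suc n"] by (simp del: eulerian_poly.simps)
  qed
  have "hurwitz_stable ((t_poly (n + 1))\<^sup>2 - t_poly (n + 2) * t_poly n)" for n
  proof (cases n)
    case 0
    \<comment> \<open>The substitution formula starts at index 1; here
      \<open>x^2 - x(1 + x) = -x\<close>.\<close>
    have "(t_poly (Suc 0))\<^sup>2 - t_poly (Suc (Suc 0)) * t_poly 0 = [:0, -1:]"
      by (simp add: t_poly_def power2_eq_square)
    thus ?thesis using 0 by (auto simp: hurwitz_stable_def)
  next
    case (Suc k)
    show ?thesis using T[of _ k] by (auto simp: hurwitz_stable_def Suc)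
  qed
  moreover have "hurwitz_stable ((M_poly (n + 1))\<^sup>2 - M_poly (n + 2) * M_poly n)" if "n \<ge> 1" for n
  proof -
    from \<open>n \<ge> 1\<close> obtain k where k: "n = Suc k" by (cases n) auto
    have M: "x * poly (M_poly (Suc m)) x = (1 + x) * poly (t_poly (Suc m)) x" for m x
      using arg_cong[OF M_poly_t_poly, of "\<lambda>p. poly p x" m] by (simp only: poly_mult) simp
    \<comment> \<open>The two Turan expressions differ by the factor \<open>(1 + x)^2 / x^2\<close>,
      which has no zero for \<open>Re x > 0\<close>.\<close>
    have "x\<^sup>2 * poly ((M_poly (Suc (Suc k)))\<^sup>2 - M_poly (Suc (Suc (Suc k))) * M_poly (Suc k)) x =
        (x * poly (M_poly (Suc (Suc k))) x)\<^sup>2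
          - (x * poly (M_poly (Suc (Suc (Suc k)))) x) * (x * poly (M_poly (Suc k)) x)" for x
      by (simp only: poly_diff poly_mult poly_power) (simp only: algebra_simps power2_eq_square)
    also have "\<dots> x = (1 + x)\<^sup>2 *
        poly ((t_poly (Suc (Suc k)))\<^sup>2 - t_poly (Suc (Suc (Suc k))) * t_poly (Suc k)) x" for x
      unfolding M by (simp only: poly_diff poly_mult poly_power) (simp only: algebra_simps power2_eq_square)
    finally have eq: "x\<^sup>2 * poly ((M_poly (Suc (Suc k)))\<^sup>2 - M_poly (Suc (Suc (Suc k))) * M_poly (Suc k)) x =
        (1 + x)\<^sup>2 * poly ((t_poly (Suc (Suc k)))\<^sup>2 - t_poly (Suc (Suc (Suc k))) * t_poly (Suc k)) x" for x .
    have "1 + x \<noteq> 0" if "Re x > 0" for x using that by (auto simp: complex_eq_iff)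
    thus ?thesis using T[of _ k] eq
      unfolding hurwitz_stable_def k by (simp del: poly_diff M_poly.simps) (metis mult_eq_0_iff power_eq_0_iff)
  qed
  ultimately show ?thesis by blast
qed

end
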